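(* Let $T$ be a complete totally transcendental theory eliminating imaginaries, $A$ a small set of parameters, and $M$ a prime model over $A$. Let $G$ be an $A$-definable group and let $P$ be an $A$-definable principal homogeneous space for $G$. If $G(M)=G(\mathrm{mcl}(A))$, then $P(M)=P(\mathrm{mcl}(A))$.
   Context: $A$ lies in a monster model $\bar M$ of $T$ and $M\prec\bar M$. The minimal closure of $A$ in $M$ is $\mathrm{mcl}(A)=\bigcap_\gamma\gamma(M)$, where $\gamma$ ranges over all elementary embeddings $\gamma:M\to M$ fixing $A$ pointwise. For an $A$-definable set $W$ and $B\subseteq M$, $W(B)$ is the set of points of $W$ with all coordinates in $B$. An $A$-definable (right) principal homogeneous space for $G$ is a nonempty $A$-definable set with a strictly transitive (i.e. simply transitive) $A$-definable right action of $G$. *)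

theory Defs
  imports "HOL-Algebra.Group"
begin

unbundle cardinal_syntax

section \<open>One-sorted first-order logic\<close>

text \<open>
  A language is a set of function symbols and a set of relation symbols, each symbol being
  paired with its arity.  The symbol sets need not exhaust the symbol types (and may be empty).
\<close>

record ('f, 'r) language =
  fsyms :: "('f \<times> nat) set"
  rsyms :: "('r \<times> nat) set"

datatype 'f trm = Var nat | Fn 'f "'f trm list"

datatype ('f, 'r) fm =
    Fls
  | Eq "'f trm" "'f trm"
  | Rel 'r "'f trm list"
  | Imp "('f, 'r) fm" "('f, 'r) fm"
  | All nat "('f, 'r) fm"

abbreviation Neg :: "('f, 'r) fm \<Rightarrow> ('f, 'r) fm" where
  "Neg \<phi> \<equiv> Imp \<phi> Fls"

fun wf_trm :: "('f, 'r) language \<Rightarrow> 'f trm \<Rightarrow> bool" where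
  "wf_trm L (Var i) \<longleftrightarrow> True"
| "wf_trm L (Fn f ts) \<longleftrightarrow> (f, length ts) \<in> fsyms L \<and> (\<forall>t\<in>set ts. wf_trm L t)"

fun wf_fm :: "('f, 'r) language \<Rightarrow> ('f, 'r) fm \<Rightarrow> bool" where
  "wf_fm L Fls \<longleftrightarrow> True"
| "wf_fm L (Eq s t) \<longleftrightarrow> wf_trm L s \<and> wf_trm L t"
| "wf_fm L (Rel r ts) \<longleftrightarrow> (r, length ts) \<in> rsyms L \<and> (\<forall>t\<in>set ts. wf_trm L t)"
| "wf_fm L (Imp \<phi> \<psi>) \<longleftrightarrow> wf_fm L \<phi> \<and> wf_fm L \<psi>"
| "wf_fm L (All i \<phi>) \<longleftrightarrow> wf_fm L \<phi>"

fun fv_trm :: "'f trm \<Rightarrow> nat set" where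
  "fv_trm (Var i) = {i}"
| "fv_trm (Fn f ts) = (\<Union>t\<in>set ts. fv_trm t)"

fun fv :: "('f, 'r) fm \<Rightarrow> nat set" where
  "fv Fls = {}"
| "fv (Eq s t) = fv_trm s \<union> fv_trm t"
| "fv (Rel r ts) = (\<Union>t\<in>set ts. fv_trm t)"
| "fv (Imp \<phi> \<psi>) = fv \<phi> \<union> fv \<psi>"
| "fv (All i \<phi>) = fv \<phi> - {i}"

definition formula :: "('f, 'r) language \<Rightarrow> nat \<Rightarrow> ('f, 'r) fm \<Rightarrow> bool" where
  "formula L n \<phi> \<longleftrightarrow> wf_fm L \<phi> \<and> fv \<phi> \<subseteq> {..<n}"

abbreviation sentence :: "('f, 'r) language \<Rightarrow> ('f, 'r) fm \<Rightarrow> bool" where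
  "sentence L \<equiv> formula L 0"

record ('f, 'r, 'a) fo_structure =
  univ :: "'a set"
  fint :: "'f \<Rightarrow> 'a list \<Rightarrow> 'a"
  rint :: "'r \<Rightarrow> 'a list \<Rightarrow> bool"

definition tuples :: "nat \<Rightarrow> 'a set \<Rightarrow> 'a list set" where
  "tuples n B = {xs. length xs = n \<and> set xs \<subseteq> B}"

definition is_structure :: "('f, 'r) language \<Rightarrow> ('f, 'r, 'a) fo_structure \<Rightarrow> bool" where
  "is_structure L N \<longleftrightarrow> univ N \<noteq> {} \<and>
     (\<forall>(f, n)\<in>fsyms L. \<forall>xs\<in>tuples n (univ N). fint N f xs \<in> univ N)"

fun eval_trm :: "('f, 'r, 'a) fo_structure \<Rightarrow> (nat \<Rightarrow> 'a) \<Rightarrow> 'f trm \<Rightarrow> 'a" where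
  "eval_trm N e (Var i) = e i"
| "eval_trm N e (Fn f ts) = fint N f (map (eval_trm N e) ts)"

fun sat :: "('f, 'r, 'a) fo_structure \<Rightarrow> (nat \<Rightarrow> 'a) \<Rightarrow> ('f, 'r) fm \<Rightarrow> bool" where
  "sat N e Fls \<longleftrightarrow> False"
| "sat N e (Eq s t) \<longleftrightarrow> eval_trm N e s = eval_trm N e t"
| "sat N e (Rel r ts) \<longleftrightarrow> rint N r (map (eval_trm N e) ts)"
| "sat N e (Imp \<phi> \<psi>) \<longleftrightarrow> (sat N e \<phi> \<longrightarrow> sat N e \<psi>)"
| "sat N e (All i \<phi>) \<longleftrightarrow> (\<forall>a\<in>univ N. sat N (e(i := a)) \<phi>)"

text \<open>
  The i-th variable is interpreted by the i-th entry of the tuple.  This is only used when the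
  free variables have indices below the length of the tuple.
\<close>

definition holds :: "('f, 'r, 'a) fo_structure \<Rightarrow> ('f, 'r) fm \<Rightarrow> 'a list \<Rightarrow> bool" where
  "holds N \<phi> xs \<longleftrightarrow> sat N (\<lambda>i. xs ! i) \<phi>"

text \<open>Sets of n-tuples definable in N by a formula with parameters from A.\<close>

definition definable ::
  "('f, 'r) language \<Rightarrow> ('f, 'r, 'a) fo_structure \<Rightarrow> 'a set \<Rightarrow> nat \<Rightarrow> 'a list set \<Rightarrow> bool" where
  "definable L N A n W \<longleftrightarrow>
     (\<exists>\<phi> cs. set cs \<subseteq> A \<and> formula L (n + length cs) \<phi> \<and>
        W = {xs \<in> tuples n (univ N). holds N \<phi> (xs @ cs)})"

text \<open>The set W(B) of points of W with all coordinates in B.\<close>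

definition points :: "'a list set \<Rightarrow> 'a set \<Rightarrow> 'a list set" where
  "points W B = {xs \<in> W. set xs \<subseteq> B}"

definition partial_elementary ::
  "('f, 'r) language \<Rightarrow> ('f, 'r, 'a) fo_structure \<Rightarrow> ('f, 'r, 'b) fo_structure \<Rightarrow>
     'a set \<Rightarrow> ('a \<Rightarrow> 'b) \<Rightarrow> bool" where
  "partial_elementary L M N B h \<longleftrightarrow> B \<subseteq> univ M \<and> h ` B \<subseteq> univ N \<and>
     (\<forall>\<phi> xs. set xs \<subseteq> B \<longrightarrow> formula L (length xs) \<phi> \<longrightarrow>
        (holds M \<phi> xs \<longleftrightarrow> holds N \<phi> (map h xs)))"

definition elementary_embedding ::
  "('f, 'r) language \<Rightarrow> ('f, 'r, 'a) fo_structure \<Rightarrow> ('f, 'r, 'b) fo_structure \<Rightarrow>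
     ('a \<Rightarrow> 'b) \<Rightarrow> bool" where
  "elementary_embedding L M N h \<longleftrightarrow> partial_elementary L M N (univ M) h"

definition elementary_substructure ::
  "('f, 'r) language \<Rightarrow> ('f, 'r, 'a) fo_structure \<Rightarrow> ('f, 'r, 'a) fo_structure \<Rightarrow> bool" where
  "elementary_substructure L M N \<longleftrightarrow> is_structure L M \<and> is_structure L N \<and>
     univ M \<subseteq> univ N \<and> elementary_embedding L M N (\<lambda>x. x)"

definition automorphism ::
  "('f, 'r) language \<Rightarrow> ('f, 'r, 'a) fo_structure \<Rightarrow> ('a \<Rightarrow> 'a) \<Rightarrow> bool" where
  "automorphism L N h \<longleftrightarrow> bij_betw h (univ N) (univ N) \<and>
     (\<forall>(f, n)\<in>fsyms L. \<forall>xs\<in>tuples n (univ N). h (fint N f xs) = fint N f (map h xs)) \<and>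
     (\<forall>(r, n)\<in>rsyms L. \<forall>xs\<in>tuples n (univ N). rint N r xs \<longleftrightarrow> rint N r (map h xs))"


section \<open>Theories\<close>

definition models ::
  "('f, 'r) language \<Rightarrow> ('f, 'r) fm set \<Rightarrow> ('f, 'r, 'a) fo_structure \<Rightarrow> bool" where
  "models L T N \<longleftrightarrow> is_structure L N \<and> (\<forall>\<phi>\<in>T. holds N \<phi> [])"

text \<open>
  HOL cannot quantify over all models of a theory on all types.  For the notions in this section
  it suffices to look at models whose elements are taken from the type of formulas: this type is
  infinite and has at least as many elements as there are formulas of L, and by the downward
  Loewenheim-Skolem theorem each notion is decided by models of at most that size.
\<close>

type_synonym ('f, 'r) small_structure = "('f, 'r, ('f, 'r) fm) fo_structure"

definition entails ::
  "('f, 'r) language \<Rightarrow> ('f, 'r) fm set \<Rightarrow> ('f, 'r) fm \<Rightarrow> bool" where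
  "entails L T \<phi> \<longleftrightarrow> (\<forall>N :: ('f, 'r) small_structure. models L T N \<longrightarrow> holds N \<phi> [])"

definition complete_theory :: "('f, 'r) language \<Rightarrow> ('f, 'r) fm set \<Rightarrow> bool" where
  "complete_theory L T \<longleftrightarrow> (\<forall>\<phi>\<in>T. sentence L \<phi>) \<and> \<not> entails L T Fls \<and>
     (\<forall>\<phi>. sentence L \<phi> \<longrightarrow> entails L T \<phi> \<or> entails L T (Neg \<phi>))"

text \<open>
  A binary tree of consistent formulas with parameters from N (given by the sets they define):
  each child implies its parent, and siblings are contradictory.
\<close>

definition has_binary_tree :: "('f, 'r) language \<Rightarrow> ('f, 'r, 'a) fo_structure \<Rightarrow> bool" where
  "has_binary_tree L N \<longleftrightarrow> (\<exists>n (D :: bool list \<Rightarrow> 'a list set). \<forall>s.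
     definable L N (univ N) n (D s) \<and> D s \<noteq> {} \<and>
     D (s @ [False]) \<union> D (s @ [True]) \<subseteq> D s \<and>
     D (s @ [False]) \<inter> D (s @ [True]) = {})"

definition totally_transcendental :: "('f, 'r) language \<Rightarrow> ('f, 'r) fm set \<Rightarrow> bool" where
  "totally_transcendental L T \<longleftrightarrow>
     (\<forall>N :: ('f, 'r) small_structure. models L T N \<longrightarrow> \<not> has_binary_tree L N)"

text \<open>
  Every class of a 0-definable equivalence relation on n-tuples has a canonical parameter: a
  tuple b that is the unique tuple for which \<open>\<theta>(x, b)\<close> defines the class, for some
  formula \<open>\<theta>\<close> without further parameters.
\<close>

definition has_canonical_parameters ::
  "('f, 'r) language \<Rightarrow> ('f, 'r, 'a) fo_structure \<Rightarrow> bool" where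
  "has_canonical_parameters L N \<longleftrightarrow> (\<forall>n \<epsilon>.
     formula L (n + n) \<epsilon> \<longrightarrow>
     equiv (tuples n (univ N))
       {(x, y). x \<in> tuples n (univ N) \<and> y \<in> tuples n (univ N) \<and> holds N \<epsilon> (x @ y)} \<longrightarrow>
     (\<forall>a\<in>tuples n (univ N). \<exists>m \<theta>. formula L (n + m) \<theta> \<and>
        (\<exists>!b. b \<in> tuples m (univ N) \<and>
           {x \<in> tuples n (univ N). holds N \<epsilon> (a @ x)} =
           {x \<in> tuples n (univ N). holds N \<theta> (x @ b)})))"

definition eliminates_imaginaries :: "('f, 'r) language \<Rightarrow> ('f, 'r) fm set \<Rightarrow> bool" where
  "eliminates_imaginaries L T \<longleftrightarrow>
     (\<forall>N :: ('f, 'r) small_structure. models L T N \<longrightarrow> has_canonical_parameters L N)"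


section \<open>Monster models, prime models and minimal closure\<close>

text \<open>Smallness relative to a cardinal \<open>\<kappa>\<close> means having fewer than \<open>\<kappa>\<close> elements.\<close>

definition small :: "'k rel \<Rightarrow> 'a set \<Rightarrow> bool" where
  "small \<kappa> B \<longleftrightarrow> |B| <o \<kappa>"

text \<open>
  The pair \<open>(\<phi>, cs)\<close> stands for the formula \<open>\<phi>(x, cs)\<close> in the single variable x.
\<close>

definition saturated :: "('f, 'r) language \<Rightarrow> 'k rel \<Rightarrow> ('f, 'r, 'a) fo_structure \<Rightarrow> bool" where
  "saturated L \<kappa> N \<longleftrightarrow>
     (\<forall>B p. B \<subseteq> univ N \<longrightarrow> small \<kappa> B \<longrightarrow>
        (\<forall>(\<phi>, cs)\<in>p. set cs \<subseteq> B \<and> formula L (1 + length cs) \<phi>) \<longrightarrow>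
        (\<forall>q. finite q \<longrightarrow> q \<subseteq> p \<longrightarrow> (\<exists>a\<in>univ N. \<forall>(\<phi>, cs)\<in>q. holds N \<phi> (a # cs))) \<longrightarrow>
        (\<exists>a\<in>univ N. \<forall>(\<phi>, cs)\<in>p. holds N \<phi> (a # cs)))"

definition strongly_homogeneous ::
  "('f, 'r) language \<Rightarrow> 'k rel \<Rightarrow> ('f, 'r, 'a) fo_structure \<Rightarrow> bool" where
  "strongly_homogeneous L \<kappa> N \<longleftrightarrow>
     (\<forall>B h. small \<kappa> B \<longrightarrow> partial_elementary L N N B h \<longrightarrow>
        (\<exists>\<sigma>. automorphism L N \<sigma> \<and> (\<forall>b\<in>B. \<sigma> b = h b)))"

text \<open>
  Since there are infinitely many formulas, the first two conjuncts make \<open>\<kappa>\<close> an uncountable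
  cardinal greater than the cardinality of the language.
\<close>

definition monster_model ::
  "('f, 'r) language \<Rightarrow> ('f, 'r) fm set \<Rightarrow> 'k rel \<Rightarrow> ('f, 'r, 'a) fo_structure \<Rightarrow> bool" where
  "monster_model L T \<kappa> N \<longleftrightarrow> Card_order \<kappa> \<and> small \<kappa> {\<phi>. wf_fm L \<phi>} \<and>
     models L T N \<and> saturated L \<kappa> N \<and> strongly_homogeneous L \<kappa> N"

text \<open>
  M is an elementary substructure of the monster model that contains A and embeds elementarily
  over A into every elementary substructure of the monster model containing A.
\<close>

definition prime_model_over ::
  "('f, 'r) language \<Rightarrow> ('f, 'r, 'a) fo_structure \<Rightarrow> 'a set \<Rightarrow> ('f, 'r, 'a) fo_structure \<Rightarrow> bool" where
  "prime_model_over L Mbar A M \<longleftrightarrow> elementary_substructure L M Mbar \<and> A \<subseteq> univ M \<and>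
     (\<forall>N. elementary_substructure L N Mbar \<longrightarrow> A \<subseteq> univ N \<longrightarrow>
        (\<exists>h. elementary_embedding L M N h \<and> (\<forall>a\<in>A. h a = a)))"

definition mcl ::
  "('f, 'r) language \<Rightarrow> ('f, 'r, 'a) fo_structure \<Rightarrow> 'a set \<Rightarrow> 'a set" where
  "mcl L M A = \<Inter> {\<gamma> ` univ M | \<gamma>. elementary_embedding L M M \<gamma> \<and> (\<forall>a\<in>A. \<gamma> a = a)}"


section \<open>Definable groups and principal homogeneous spaces\<close>

definition definable_group ::
  "('f, 'r) language \<Rightarrow> ('f, 'r, 'a) fo_structure \<Rightarrow> 'a set \<Rightarrow> nat \<Rightarrow> 'a list monoid \<Rightarrow> bool" where
  "definable_group L N A n G \<longleftrightarrow> group G \<and> definable L N A n (carrier G) \<and>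
     definable L N A (n + n + n) {x @ y @ (x \<otimes>\<^bsub>G\<^esub> y) | x y. x \<in> carrier G \<and> y \<in> carrier G}"

definition definable_phs ::
  "('f, 'r) language \<Rightarrow> ('f, 'r, 'a) fo_structure \<Rightarrow> 'a set \<Rightarrow> nat \<Rightarrow> 'a list monoid \<Rightarrow>
     nat \<Rightarrow> 'a list set \<Rightarrow> ('a list \<Rightarrow> 'a list \<Rightarrow> 'a list) \<Rightarrow> bool" where
  "definable_phs L N A n G k P act \<longleftrightarrow>
     definable L N A k P \<and> P \<noteq> {} \<and>
     definable L N A (k + n + k) {p @ g @ act p g | p g. p \<in> P \<and> g \<in> carrier G} \<and>
     (\<forall>p\<in>P. \<forall>g\<in>carrier G. act p g \<in> P) \<and>
     (\<forall>p\<in>P. act p \<one>\<^bsub>G\<^esub> = p) \<and>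
     (\<forall>p\<in>P. \<forall>g\<in>carrier G. \<forall>h\<in>carrier G. act (act p g) h = act p (g \<otimes>\<^bsub>G\<^esub> h)) \<and>
     (\<forall>p\<in>P. \<forall>q\<in>P. \<exists>!g. g \<in> carrier G \<and> act p g = q)"

end

theory Submission
  imports Defs
begin

text \<open>
  Let \<open>\<gamma>\<close> be an elementary embedding of M into itself over A and let p be in P(M).  Then
  \<open>\<gamma> p\<close> is in P(M), so \<open>p = (\<gamma> p) g\<close> for a unique g in G, which is
  definable over A, p and \<open>\<gamma> p\<close> and hence lies in \<open>G(M) = G(mcl A)\<close>.
  Therefore \<open>\<gamma> p\<close> and g both have their coordinates in \<open>\<gamma>(M)\<close>, which is an
  elementary substructure containing A, so it contains the coordinates of p as well.
\<close>

section \<open>Assignments and blocks of quantifiers\<close>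

lemma eval_trm_cong: "(\<And>i. i \<in> fv_trm t \<Longrightarrow> e i = e' i) \<Longrightarrow> eval_trm N e t = eval_trm N e' t"
proof (induction t)
  case (Fn f ts)
  have "map (eval_trm N e) ts = map (eval_trm N e') ts"
    using Fn by (intro map_cong) auto
  then show ?case by (simp only: eval_trm.simps)
qed simp

lemma sat_cong: "(\<And>i. i \<in> fv \<phi> \<Longrightarrow> e i = e' i) \<Longrightarrow> sat N e \<phi> \<longleftrightarrow> sat N e' \<phi>"
proof (induction \<phi> arbitrary: e e')
  case (Eq s t)
  then show ?case by (auto simp: eval_trm_cong[of s e e'] eval_trm_cong[of t e e'])
next
  case (Rel r ts)
  have "map (eval_trm N e) ts = map (eval_trm N e') ts"
    using Rel by (intro map_cong) (auto intro: eval_trm_cong)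
  then show ?case by (simp only: sat.simps)
next
  case (Imp \<phi> \<psi>)
  then show ?case by (metis UnCI fv.simps(4) sat.simps(4))
next
  case (All i \<phi>)
  have "sat N (e(i := a)) \<phi> \<longleftrightarrow> sat N (e'(i := a)) \<phi>" for a
    using All.prems by (intro All.IH) auto
  then show ?case by simp
qed simp

text \<open>A block of quantifiers lets a finite set of coordinates be changed all at once, so that
  no iteration over single variables is needed later. Repetitions in the list are harmless: only its
  set of entries matters.\<close>

lemma sat_foldr_All:
  "sat N e (foldr All is \<phi>) \<longleftrightarrow>
     (\<forall>e'. (\<forall>j\<in>set is. e' j \<in> univ N) \<and> (\<forall>j. j \<notin> set is \<longrightarrow> e' j = e j) \<longrightarrow> sat N e' \<phi>)"
proof (induction "is" arbitrary: e)
  case Nil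
  have "e' = e" if "\<forall>j. e' j = e j" for e' using that by auto
  then show ?case by auto
next
  case (Cons i js)
  show ?case
  proof
    assume l: "sat N e (foldr All (i # js) \<phi>)"
    show "\<forall>e'. (\<forall>j\<in>set (i # js). e' j \<in> univ N) \<and>
        (\<forall>j. j \<notin> set (i # js) \<longrightarrow> e' j = e j) \<longrightarrow> sat N e' \<phi>"
    proof (intro allI impI)
      fix e' assume e': "(\<forall>j\<in>set (i # js). e' j \<in> univ N) \<and>
        (\<forall>j. j \<notin> set (i # js) \<longrightarrow> e' j = e j)"
      then have "sat N (e(i := e' i)) (foldr All js \<phi>)" using l by simp
      then show "sat N e' \<phi>" using e' by (auto simp: Cons.IH)
    qed
  next
    assume r: "\<forall>e'. (\<forall>j\<in>set (i # js). e' j \<in> univ N) \<and>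
        (\<forall>j. j \<notin> set (i # js) \<longrightarrow> e' j = e j) \<longrightarrow> sat N e' \<phi>"
    have "sat N (e(i := a)) (foldr All js \<phi>)" if "a \<in> univ N" for a
      unfolding Cons.IH
    proof (intro allI impI)
      fix e' assume e': "(\<forall>j\<in>set js. e' j \<in> univ N) \<and> (\<forall>j. j \<notin> set js \<longrightarrow> e' j = (e(i := a)) j)"
      \<comment> \<open>If \<open>i\<close> occurs again in \<open>js\<close>, the inner quantifier
        bounds \<open>e' i\<close>; otherwise \<open>e' i\<close> is \<open>a\<close>.\<close>
      then have "e' i \<in> univ N" using that by (cases "i \<in> set js") auto
      with e' show "sat N e' \<phi>" by (intro r[rule_format]) simp
    qed
    then show "sat N e (foldr All (i # js) \<phi>)" by simp
  qed
qed

lemma formula_foldr_All: "formula L l \<phi> \<Longrightarrow> formula L l (foldr All is \<phi>)"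
  by (induction "is") (auto simp: formula_def)

lemma formula_Neg: "formula L l (Neg \<phi>) \<longleftrightarrow> formula L l \<phi>"
  by (simp add: formula_def)

section \<open>Elementary embeddings and definable sets\<close>

lemma elementary_embedding_sat:
  assumes h: "elementary_embedding L M N h" and \<phi>: "formula L l \<phi>"
    and e: "\<And>i. i < l \<Longrightarrow> e i \<in> univ M"
  shows "sat M e \<phi> \<longleftrightarrow> sat N (h \<circ> e) \<phi>"
proof -
  \<comment> \<open>Only the values of \<open>e\<close> below \<open>l\<close> can matter to
    \<open>\<phi>\<close>, so satisfaction under \<open>e\<close> is truth at this tuple.\<close>
  let ?xs = "map e [0..<l]"
  have "set ?xs \<subseteq> univ M" using e by auto
  then have "holds M \<phi> ?xs \<longleftrightarrow> holds N \<phi> (map h ?xs)"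
    using h \<phi> unfolding elementary_embedding_def partial_elementary_def by auto
  moreover have "holds M \<phi> ?xs \<longleftrightarrow> sat M e \<phi>"
    unfolding holds_def by (rule sat_cong) (use \<phi> in \<open>auto simp: formula_def subset_iff\<close>)
  moreover have "holds N \<phi> (map h ?xs) \<longleftrightarrow> sat N (h \<circ> e) \<phi>"
    unfolding holds_def by (rule sat_cong) (use \<phi> in \<open>auto simp: formula_def subset_iff\<close>)
  ultimately show ?thesis by simp
qed

text \<open>Tarski-Vaught for several variables: the coordinates in \<open>I\<close> of a solution
  can be moved into the image of \<open>h\<close>, since the existence of a solution over the
  remaining coordinates passes down to \<open>M\<close>, and a solution found there passes up
  again.\<close>

lemma tarski_vaught:
  assumes h: "elementary_embedding L M N h" and \<phi>: "formula L l \<phi>"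
    and e: "\<And>i. e i \<in> univ M"
    and e': "\<And>i. i \<in> I \<Longrightarrow> e' i \<in> univ N" "\<And>i. i \<notin> I \<Longrightarrow> e' i = h (e i)"
    and I: "finite I" and sat: "sat N e' \<phi>"
  shows "\<exists>d. (\<forall>i. d i \<in> univ M) \<and> (\<forall>i. i \<notin> I \<longrightarrow> d i = e i) \<and> sat N (h \<circ> d) \<phi>"
proof -
  obtain "is" where "is": "set is = I" using I finite_list by blast
  \<comment> \<open>The negation of \<open>?\<psi>\<close> says that the variables in
    \<open>I\<close> can be chosen to satisfy \<open>\<phi>\<close>; in \<open>N\<close>,
    \<open>e'\<close> is such a choice.\<close>
  let ?\<psi> = "foldr All is (Neg \<phi>)"
  have "\<not> sat N (h \<circ> e) ?\<psi>"
    using e' sat unfolding sat_foldr_All "is" by auto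
  moreover have "formula L l ?\<psi>"
    using \<phi> by (simp add: formula_foldr_All formula_Neg)
  ultimately have "\<not> sat M e ?\<psi>"
    using elementary_embedding_sat[OF h] e by blast
  then obtain d where d: "\<And>i. i \<in> I \<Longrightarrow> d i \<in> univ M" "\<And>i. i \<notin> I \<Longrightarrow> d i = e i" "sat M d \<phi>"
    unfolding sat_foldr_All "is" by auto
  have dM: "d i \<in> univ M" for i using d e by (cases "i \<in> I") auto
  then have "sat N (h \<circ> d) \<phi>" using elementary_embedding_sat[OF h \<phi>, of d] d by blast
  then show ?thesis using d dM by blast
qed

text \<open>This replaces a definable closure argument: if a point of \<open>D\<close> is determined
  by its coordinates outside \<open>I\<close>, and these lie in the image of \<open>h\<close>, then
  the \<open>ys\<close> obtained is the point itself, so all its coordinates lie in the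
  image.\<close>

lemma definable_point_in_range:
  assumes h: "elementary_embedding L M N h" and M: "univ M \<noteq> {}"
    and A: "A \<subseteq> univ M" "\<forall>a\<in>A. h a = a"
    and D: "definable L N A l D" and xs: "xs \<in> D"
    and out: "\<And>i. i < l \<Longrightarrow> i \<notin> I \<Longrightarrow> xs ! i \<in> h ` univ M"
  shows "\<exists>ys\<in>D. set ys \<subseteq> h ` univ M \<and> (\<forall>i<l. i \<notin> I \<longrightarrow> ys ! i = xs ! i)"
proof -
  obtain \<phi> cs where cs: "set cs \<subseteq> A" and \<phi>: "formula L (l + length cs) \<phi>"
    and D_eq: "D = {xs \<in> tuples l (univ N). holds N \<phi> (xs @ cs)}"
    using D unfolding definable_def by blast
  have hM: "h ` univ M \<subseteq> univ N"
    using h unfolding elementary_embedding_def partial_elementary_def by blast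
  have len: "length xs = l" and xsN: "set xs \<subseteq> univ N" and hol: "holds N \<phi> (xs @ cs)"
    using xs unfolding D_eq tuples_def by auto
  obtain m where m: "m \<in> univ M" using M by blast
  \<comment> \<open>\<open>I\<close> may be infinite. Cutting it down to the positions below
    \<open>l\<close> makes it finite and keeps the parameters \<open>cs\<close> unchanged.\<close>
  define J where "J = I \<inter> {..<l}"
  \<comment> \<open>Preimages for the retained positions: coordinates of \<open>xs\<close> have them
    by assumption, and parameters are their own preimages because \<open>h\<close> fixes
    \<open>A\<close>. Elsewhere \<open>m\<close> is a default value.\<close>
  have "\<exists>a. a \<in> univ M \<and> (i < l + length cs \<and> i \<notin> J \<longrightarrow> (xs @ cs) ! i = h a)" for i
  proof (cases "i < l + length cs \<and> i \<notin> J")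
    case True
    show ?thesis
    proof (cases "i < l")
      case True
      then show ?thesis using out[of i] \<open>_ \<and> i \<notin> J\<close> len by (auto simp: J_def nth_append)
    next
      case False
      then have "cs ! (i - l) \<in> A" using True cs by (auto simp: subset_iff)
      then show ?thesis using A False len by (intro exI[of _ "cs ! (i - l)"]) (auto simp: nth_append)
    qed
  qed (use m in blast)
  then obtain e where e: "\<And>i. e i \<in> univ M"
    and he: "\<And>i. i < l + length cs \<Longrightarrow> i \<notin> J \<Longrightarrow> (xs @ cs) ! i = h (e i)"
    by metis
  \<comment> \<open>Past the end of the list \<open>nth\<close> is unspecified; there the value is
    taken from \<open>h \<circ> e\<close>, so that \<open>e'\<close> agrees with
    \<open>h \<circ> e\<close> everywhere outside \<open>J\<close>.\<close>
  define e' where "e' i = (if i < l + length cs then (xs @ cs) ! i else h (e i))" for i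
  have sat: "sat N e' \<phi>"
    using hol sat_cong[of \<phi> e' "\<lambda>i. (xs @ cs) ! i"] \<phi>
    unfolding holds_def by (auto simp: formula_def subset_iff e'_def)
  have e'_in: "e' i \<in> univ N" if "i \<in> J" for i
    using that xsN len by (auto simp: J_def e'_def nth_append subset_iff)
  have e'_out: "e' i = h (e i)" if "i \<notin> J" for i
    using he that by (auto simp: e'_def)
  have J: "finite J" by (simp add: J_def)
  obtain d where d: "\<And>i. d i \<in> univ M" "\<And>i. i \<notin> J \<Longrightarrow> d i = e i" "sat N (h \<circ> d) \<phi>"
    using tarski_vaught[OF h \<phi> e e'_in e'_out J sat] by blast
  let ?ys = "map (h \<circ> d) [0..<l]"
  have "(?ys @ cs) ! i = h (d i)" if "i < l + length cs" for i
  proof (cases "i < l")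
    case False
    then have "i \<notin> J" by (simp add: J_def)
    then show ?thesis using he[of i] that d(2)[of i] False len by (simp add: nth_append)
  qed (simp add: nth_append)
  then have "holds N \<phi> (?ys @ cs)"
    using d(3) sat_cong[of \<phi> "h \<circ> d" "\<lambda>i. (?ys @ cs) ! i"] \<phi>
    unfolding holds_def by (auto simp: formula_def subset_iff)
  then have "?ys \<in> D" using d(1) hM unfolding D_eq tuples_def by auto
  moreover have "?ys ! i = xs ! i" if "i < l" "i \<notin> I" for i
    using he[of i] that d(2)[of i] len by (auto simp: J_def nth_append)
  ultimately show ?thesis using d(1) by (intro bexI[of _ ?ys]) auto
qed

lemma elementary_embedding_trans:
  assumes f: "elementary_embedding L M N f" and g: "elementary_embedding L N K g"
  shows "elementary_embedding L M K (g \<circ> f)"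
proof -
  have fM: "f ` univ M \<subseteq> univ N" and gN: "g ` univ N \<subseteq> univ K"
    using f g unfolding elementary_embedding_def partial_elementary_def by auto
  have "holds M \<phi> xs \<longleftrightarrow> holds K \<phi> (map (g \<circ> f) xs)"
    if "set xs \<subseteq> univ M" "formula L (length xs) \<phi>" for \<phi> xs
  proof -
    have "holds M \<phi> xs \<longleftrightarrow> holds N \<phi> (map f xs)"
      using f that unfolding elementary_embedding_def partial_elementary_def by auto
    also have "\<dots> \<longleftrightarrow> holds K \<phi> (map g (map f xs))"
    proof -
      have "set (map f xs) \<subseteq> univ N" "formula L (length (map f xs)) \<phi>" using fM that by auto
      then show ?thesis using g unfolding elementary_embedding_def partial_elementary_def by blast
    qed
    finally show ?thesis by simp
  qed
  then show ?thesis
    using fM gN unfolding elementary_embedding_def partial_elementary_def by fastforce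
qed

lemma mcl_subset: "mcl L M A \<subseteq> univ M"
proof -
  have "elementary_embedding L M M (\<lambda>x. x)"
    by (simp add: elementary_embedding_def partial_elementary_def)
  then show ?thesis unfolding mcl_def by (intro Inter_lower) force
qed

text \<open>\<open>D\<close> is defined in \<open>N\<close>, so the truth of its formula is first
  pulled back to \<open>M\<close> along the inclusion and then pushed forward along
  \<open>h\<close>; the parameters do not move.\<close>

lemma definable_image:
  assumes i: "elementary_embedding L M N (\<lambda>x. x)" and h: "elementary_embedding L M N h"
    and A: "A \<subseteq> univ M" "\<forall>a\<in>A. h a = a"
    and D: "definable L N A l D" and xs: "xs \<in> D" "set xs \<subseteq> univ M"
  shows "map h xs \<in> D"
proof -
  obtain \<phi> cs where cs: "set cs \<subseteq> A" and \<phi>: "formula L (l + length cs) \<phi>"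
    and D_eq: "D = {xs \<in> tuples l (univ N). holds N \<phi> (xs @ cs)}"
    using D unfolding definable_def by blast
  have len: "length xs = l" and hol: "holds N \<phi> (xs @ cs)"
    using xs unfolding D_eq tuples_def by auto
  have sub: "set (xs @ cs) \<subseteq> univ M" and frm: "formula L (length (xs @ cs)) \<phi>"
    using cs A xs \<phi> len by auto
  have "holds M \<phi> (xs @ cs) \<longleftrightarrow> holds N \<phi> (map (\<lambda>x. x) (xs @ cs))"
    using i sub frm unfolding elementary_embedding_def partial_elementary_def by blast
  moreover have "holds M \<phi> (xs @ cs) \<longleftrightarrow> holds N \<phi> (map h (xs @ cs))"
    using h sub frm unfolding elementary_embedding_def partial_elementary_def by blast
  moreover have "map h cs = cs" using A cs by (auto intro: map_idI)
  ultimately have "holds N \<phi> (map h xs @ cs)" using hol by simp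
  moreover have "h ` univ M \<subseteq> univ N"
    using h unfolding elementary_embedding_def partial_elementary_def by blast
  ultimately show ?thesis using len xs unfolding D_eq tuples_def by auto
qed

theorem lemma1p9:
  fixes L :: "('f, 'r) language"
    and T :: "('f, 'r) fm set"
    and \<kappa> :: "'k rel"
    and Mbar M :: "('f, 'r, 'm) fo_structure"
    and A :: "'m set"
    and G :: "'m list monoid"
    and P :: "'m list set"
    and act :: "'m list \<Rightarrow> 'm list \<Rightarrow> 'm list"
    and n k :: nat
  assumes "complete_theory L T"
    and "totally_transcendental L T"
    and "eliminates_imaginaries L T"
    and "monster_model L T \<kappa> Mbar"
    and "A \<subseteq> univ Mbar" and "small \<kappa> A"
    and "prime_model_over L Mbar A M"
    and "definable_group L Mbar A n G"
    and "definable_phs L Mbar A n G k P act"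
    and "points (carrier G) (univ M) = points (carrier G) (mcl L M A)"
  shows "points P (univ M) = points P (mcl L M A)"
proof -
  have el: "elementary_substructure L M Mbar" and AM: "A \<subseteq> univ M"
    using assms(7) unfolding prime_model_over_def by auto
  have incl: "elementary_embedding L M Mbar (\<lambda>x. x)" and M: "univ M \<noteq> {}"
    using el unfolding elementary_substructure_def is_structure_def by auto
  let ?D = "{p @ g @ act p g | p g. p \<in> P \<and> g \<in> carrier G}"
  have defP: "definable L Mbar A k P" and defD: "definable L Mbar A (k + n + k) ?D"
    and actP: "\<And>p g. p \<in> P \<Longrightarrow> g \<in> carrier G \<Longrightarrow> act p g \<in> P"
    and tr: "\<And>p q. p \<in> P \<Longrightarrow> q \<in> P \<Longrightarrow> \<exists>!g. g \<in> carrier G \<and> act p g = q"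
    using assms(9) unfolding definable_phs_def by auto
  have idA: "\<forall>a\<in>A. (\<lambda>x. x) a = a" by simp
  have defG: "definable L Mbar A n (carrier G)"
    using assms(8) unfolding definable_group_def by auto
  have lenP: "length p = k" if "p \<in> P" for p
    using defP that unfolding definable_def tuples_def by auto
  have lenG: "length g = n" if "g \<in> carrier G" for g
    using defG that unfolding definable_def tuples_def by auto
  have "set p \<subseteq> \<gamma> ` univ M"
    if p: "p \<in> P" "set p \<subseteq> univ M" and \<gamma>: "elementary_embedding L M M \<gamma>" "\<forall>a\<in>A. \<gamma> a = a" for p \<gamma>
  proof -
    \<comment> \<open>\<open>P\<close> and the action are definable in \<open>Mbar\<close>, so
      \<open>\<gamma>\<close> is viewed as a map into \<open>Mbar\<close>.\<close>
    have \<gamma>': "elementary_embedding L M Mbar \<gamma>"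
      using elementary_embedding_trans[OF \<gamma>(1) incl] by (simp add: comp_def)
    define q where "q = map \<gamma> p"
    have q: "q \<in> P"
      unfolding q_def by (rule definable_image[OF incl \<gamma>' AM \<gamma>(2) defP p])
    have q\<gamma>: "set q \<subseteq> \<gamma> ` univ M" using p by (auto simp: q_def)
    have "\<gamma> ` univ M \<subseteq> univ M"
      using \<gamma> unfolding elementary_embedding_def partial_elementary_def by blast
    with q\<gamma> have qM: "set q \<subseteq> univ M" by blast
    obtain g where g: "g \<in> carrier G" "act q g = p"
      using tr[OF q p(1)] by blast
    \<comment> \<open>A point of the graph of the action. At this stage \<open>g\<close> is only
      known to lie in \<open>G\<close>, possibly with coordinates outside \<open>M\<close>.\<close>
    let ?xs = "q @ g @ p"
    have xs: "?xs \<in> ?D" using q g by blast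
    have len: "length p = k" "length q = k" "length g = n"
      using lenP lenG p q g by auto
    \<comment> \<open>First use of the graph, with the inclusion of \<open>M\<close>: the outer
      blocks \<open>q\<close> and \<open>p\<close> are kept and the middle block is free.\<close>
    have "?xs ! i \<in> (\<lambda>x. x) ` univ M" if "i < k + n + k" "i \<notin> {k..<k + n}" for i
      using that len p(2) qM by (auto simp: nth_append subset_iff)
    from definable_point_in_range[OF incl M AM idA defD xs this, unfolded image_ident]
    obtain ys where ys: "ys \<in> ?D" "set ys \<subseteq> univ M \<and>
        (\<forall>i<k + n + k. i \<notin> {k..<k + n} \<longrightarrow> ys ! i = ?xs ! i)"
      by (rule bexE)
    obtain q' g' where y: "ys = q' @ g' @ act q' g'" "q' \<in> P" "g' \<in> carrier G"
      using ys(1) by blast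
    note len' = lenP[OF y(2)] lenG[OF y(3)] lenP[OF actP[OF y(2,3)]]
    have "q' ! i = q ! i" if "i < k" for i
      using conjunct2[OF ys(2), rule_format, of i] that len len' by (simp add: y nth_append)
    then have "q' = q" using len len' by (simp add: list_eq_iff_nth_eq)
    have "act q' g' ! i = p ! i" if "i < k" for i
      using conjunct2[OF ys(2), rule_format, of "k + n + i"] that len len' by (simp add: y nth_append)
    then have "act q' g' = p" using len len' by (simp add: list_eq_iff_nth_eq)
    \<comment> \<open>Simple transitivity: the middle block is determined by the outer two, so the
      replacement found in \<open>M\<close> is \<open>g\<close> itself.\<close>
    then have "g' = g" using \<open>q' = q\<close> tr[OF q p(1)] g y(3) by blast
    then have "set g \<subseteq> univ M" using ys(2) y by auto
    then have "g \<in> points (carrier G) (mcl L M A)"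
      using g assms(10) unfolding points_def by blast
    moreover have "mcl L M A \<subseteq> \<gamma> ` univ M"
      unfolding mcl_def using \<gamma> by (intro Inter_lower) blast
    ultimately have g\<gamma>: "set g \<subseteq> \<gamma> ` univ M" unfolding points_def by blast
    \<comment> \<open>Second use of the graph, now with \<open>\<gamma>\<close>: the blocks
      \<open>q\<close> and \<open>g\<close> are kept and the last one is free.\<close>
    have "?xs ! i \<in> \<gamma> ` univ M" if "i < k + n + k" "i \<notin> {k + n..}" for i
    proof -
      have "?xs ! i \<in> set q \<union> set g"
        using that len by (auto simp: nth_append)
      then show ?thesis using q\<gamma> g\<gamma> by blast
    qed
    from definable_point_in_range[OF \<gamma>' M AM \<gamma>(2) defD xs this]
    obtain zs where zs: "zs \<in> ?D" "set zs \<subseteq> \<gamma> ` univ M \<and>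
        (\<forall>i<k + n + k. i \<notin> {k + n..} \<longrightarrow> zs ! i = ?xs ! i)"
      by (rule bexE)
    obtain q'' g'' where z: "zs = q'' @ g'' @ act q'' g''" "q'' \<in> P" "g'' \<in> carrier G"
      using zs(1) by blast
    note len'' = lenP[OF z(2)] lenG[OF z(3)]
    have "q'' ! i = q ! i" if "i < k" for i
      using conjunct2[OF zs(2), rule_format, of i] that len len'' by (simp add: z nth_append)
    then have "q'' = q" using len len'' by (simp add: list_eq_iff_nth_eq)
    have "g'' ! i = g ! i" if "i < n" for i
      using conjunct2[OF zs(2), rule_format, of "k + i"] that len len'' by (simp add: z nth_append)
    then have "g'' = g" using len len'' by (simp add: list_eq_iff_nth_eq)
    \<comment> \<open>The last block of \<open>zs\<close> is \<open>act q g\<close>, which is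
      \<open>p\<close>; the action being a function takes the place of uniqueness here.\<close>
    show ?thesis using zs(2) \<open>q'' = q\<close> \<open>g'' = g\<close> g(2) z(1) by auto
  qed
  then have "set p \<subseteq> mcl L M A" if "p \<in> P" "set p \<subseteq> univ M" for p
    using that unfolding mcl_def by blast
  then show ?thesis using mcl_subset[of L M A] unfolding points_def by blast
qed

end
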